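(* Let $L$ be a complete atomistic lattice and let $\mathfrak{T}(L)=\{\overline{T}\mid T\text{ a t-norm on }C(L)\}$, where $C(L)=A(L)\cup\{0,1\}$ and $\overline{T}(x,y)=\bigvee_{u\in\kappa(x)}\bigvee_{v\in\kappa(y)}T(u,v)$ with $\kappa(x)=\{u\in C(L)\setminus\{0\}\mid u\le x\}$. Then the poset $(\mathfrak{T}(L),\le)$, ordered pointwise ($T_1\le T_2$ iff $T_1(x,y)\le T_2(x,y)$ for all $x,y\in L$), is order-isomorphic to the power set $(\mathcal{P}(A(L)),\subseteq)$.
   Context: A lattice $L$ with bottom $0$ and top $1$ is atomistic if every element is a join of atoms (elements covering $0$); $A(L)$ is the set of atoms and $C(L)=A(L)\cup\{0,1\}$ has the order inherited from $L$. A t-norm on a bounded poset with top $1$ is a binary operation that is monotone in each argument, commutative, associative, with neutral element $1$.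
   Formalization: It is additionally assumed that 1 is not an atom, which excludes only the two-element lattice L = {0,1}; there the claim fails, since C(L) has exactly one t-norm while the power set of A(L) = {1} has two elements. *)

theory Defs
  imports Main
begin

definition atoms :: "'a::order_bot set"
  where "atoms = {a. bot < a \<and> \<not> (\<exists>z. bot < z \<and> z < a)}"

definition C :: "'a::{order_bot, order_top} set"
  where "C = atoms \<union> {bot, top}"

(* A t-norm on the subposet P (containing top) with the inherited order. Only the
   values of T on P \<times> P are constrained. *)
definition tnorm_on :: "'a::order_top set \<Rightarrow> ('a \<Rightarrow> 'a \<Rightarrow> 'a) \<Rightarrow> bool"
  where "tnorm_on P T \<longleftrightarrow>
    (\<forall>x\<in>P. \<forall>y\<in>P. T x y \<in> P) \<and>
    (\<forall>x\<in>P. \<forall>x'\<in>P. \<forall>y\<in>P. x \<le> x' \<longrightarrow> T x y \<le> T x' y) \<and>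
    (\<forall>x\<in>P. \<forall>y\<in>P. \<forall>y'\<in>P. y \<le> y' \<longrightarrow> T x y \<le> T x y') \<and>
    (\<forall>x\<in>P. \<forall>y\<in>P. T x y = T y x) \<and>
    (\<forall>x\<in>P. \<forall>y\<in>P. \<forall>z\<in>P. T (T x y) z = T x (T y z)) \<and>
    (\<forall>x\<in>P. T x top = x \<and> T top x = x)"

definition kappa :: "'a::{order_bot, order_top} \<Rightarrow> 'a set"
  where "kappa x = {u \<in> C - {bot}. u \<le> x}"

(* Depends on T only through its values on C \<times> C, so distinct T agreeing there give
   the same element of ext_tnorms. *)
definition ext :: "('a \<Rightarrow> 'a \<Rightarrow> 'a) \<Rightarrow> 'a::complete_lattice \<Rightarrow> 'a \<Rightarrow> 'a"
  where "ext T x y = (SUP u\<in>kappa x. SUP v\<in>kappa y. T u v)"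

definition ext_tnorms :: "('a::complete_lattice \<Rightarrow> 'a \<Rightarrow> 'a) set"
  where "ext_tnorms = {ext T |T. tnorm_on C T}"

(* Subsets ordered by the ambient order: pointwise on functions, inclusion on sets. *)
definition order_isomorphic :: "'a::order set \<Rightarrow> 'b::order set \<Rightarrow> bool"
  where "order_isomorphic X Y \<longleftrightarrow>
    (\<exists>f. bij_betw f X Y \<and> (\<forall>x\<in>X. \<forall>y\<in>X. x \<le> y \<longleftrightarrow> f x \<le> f y))"

end

(* Distinct atoms have meet 0 and T x y lies below x and y, so a t-norm on C(L) is free only
   in its values T a a, which are a or 0 for each atom a. Every choice is a t-norm, so t-norms
   correspond to their sets of idempotent atoms. As kappa a = {a} for an atom a, the
   extension to L still determines this set, and larger sets give larger extensions. *)
theory Submission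
  imports Defs
begin

text \<open>Defined on the whole type, so commutativity and associativity hold without membership in
  \<open>C\<close>.\<close>

definition tnorm_of :: "'a set \<Rightarrow> 'a \<Rightarrow> 'a \<Rightarrow> 'a::{order_bot, order_top}"
  where "tnorm_of S x y =
    (if x = top then y else if y = top then x else if x = y \<and> x \<in> S then x else bot)"

text \<open>Taken for any binary operation, so that it applies both to a t-norm on \<open>C\<close>
  and to its extension.\<close>

definition idem_atoms :: "('a \<Rightarrow> 'a \<Rightarrow> 'a) \<Rightarrow> 'a::order_bot set"
  where "idem_atoms F = {a \<in> atoms. F a a = a}"

lemma le_atomD: "a \<in> atoms \<Longrightarrow> x \<le> a \<Longrightarrow> x = bot \<or> x = a"
  unfolding atoms_def by (auto simp: bot_less order.strict_iff_order)

lemma kappa_atom: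
  fixes a :: "'a::{order_bot, order_top}"
  assumes "a \<in> atoms"
  shows "kappa a = {a}"
proof -
  have "a \<noteq> bot" using assms by (auto simp: atoms_def)
  then show ?thesis using le_atomD[OF assms] assms by (auto simp: kappa_def C_def)
qed

lemma ext_atom: "a \<in> atoms \<Longrightarrow> ext T a a = T a a"
  by (simp add: ext_def kappa_atom)

lemma ext_cong:
  assumes "\<And>u v. u \<in> C \<Longrightarrow> v \<in> C \<Longrightarrow> T u v = T' u v"
  shows "ext T = ext T'"
  unfolding ext_def using assms by (intro ext SUP_cong refl) (auto simp: kappa_def)

lemma ext_mono:
  assumes "\<And>u v. T u v \<le> T' u v"
  shows "ext T \<le> ext T'"
  unfolding ext_def le_fun_def using assms by (intro allI SUP_mono') simp

lemma tnorm_on_tnorm_of: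
  fixes S :: "'a::{order_bot, order_top} set"
  shows "tnorm_on C (tnorm_of S)"
proof -
  have mono1: "tnorm_of S x y \<le> tnorm_of S x' y"
    if "x \<in> C" "x' \<in> C" "x \<le> x'" for x x' y :: 'a
  \<comment> \<open>A strict comparison inside \<open>C\<close> always has \<open>bot\<close> below
    or \<open>top\<close> above, since only \<open>bot\<close> lies strictly below an atom.\<close>
  proof (cases "x = x' \<or> x = bot \<or> x' = top")
    case True
    then show ?thesis using that(3) by (auto simp: tnorm_of_def top_unique)
  next
    case False
    then have "x' \<in> atoms" using that by (auto simp: C_def top_unique bot_unique)
    then show ?thesis using le_atomD[of x' x] that False by blast
  qed
  have comm: "tnorm_of S x y = tnorm_of S y x" for x y :: 'a
    by (auto simp: tnorm_of_def)
  have assoc: "tnorm_of S (tnorm_of S x y) z = tnorm_of S x (tnorm_of S y z)" for x y z :: 'a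
  proof (cases "x = top \<or> y = top \<or> z = top")
    case True
    then show ?thesis by (auto simp: tnorm_of_def)
  next
    case False
    \<comment> \<open>An inner product may collapse to \<open>bot\<close>, which must not be
      mistaken for the neutral element.\<close>
    then have "(bot :: 'a) \<noteq> top" by (metis bot_least top_unique)
    then show ?thesis using False by (cases "x = y"; cases "y = z"; simp add: tnorm_of_def)
  qed
  have closed: "tnorm_of S x y \<in> C" if "x \<in> C" "y \<in> C" for x y :: 'a
    using that by (auto simp: tnorm_of_def C_def)
  have mono2: "tnorm_of S x y \<le> tnorm_of S x y'"
    if "y \<in> C" "y' \<in> C" "y \<le> y'" for x y y' :: 'a
    using mono1[OF that] comm by metis
  have neutral: "tnorm_of S x top = x" "tnorm_of S top x = x" for x :: 'a
    by (simp_all add: tnorm_of_def)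
  show ?thesis
    unfolding tnorm_on_def
    by (intro conjI ballI impI closed mono1 mono2 assoc neutral comm; assumption)
qed

text \<open>Raising either argument to \<open>top\<close> bounds \<open>T x y\<close> by the other
  one. Below two atoms this leaves only \<open>bot\<close> or, when they coincide, the atom
  itself.\<close>

lemma tnorm_on_eq_tnorm_of:
  fixes T :: "'a::{order_bot, order_top} \<Rightarrow> 'a \<Rightarrow> 'a"
  assumes T: "tnorm_on C T" and "x \<in> C" "y \<in> C"
  shows "T x y = tnorm_of (idem_atoms T) x y"
proof -
  have top_C: "(top::'a) \<in> C" by (simp add: C_def)
  have neutral: "T x top = x" "T top y = y"
    using T assms unfolding tnorm_on_def by auto
  have "T x y \<le> T x' y" if "x' \<in> C" "x \<le> x'" for x'
    using T assms that unfolding tnorm_on_def by simp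
  moreover have "T x y \<le> T x y'" if "y' \<in> C" "y \<le> y'" for y'
    using T assms that unfolding tnorm_on_def by simp
  ultimately have "T x y \<le> T x top" "T x y \<le> T top y"
    using top_C by simp_all
  then have le: "T x y \<le> x" "T x y \<le> y" using neutral by simp_all
  show ?thesis
  proof (cases "x = top \<or> y = top \<or> x = bot \<or> y = bot")
    case True
    then show ?thesis
      using neutral le by (auto simp: tnorm_of_def bot_unique)
  next
    case False
    then have "x \<in> atoms" "y \<in> atoms" using assms by (auto simp: C_def)
    then have "T x y = bot \<or> T x y = x" "T x y = bot \<or> T x y = y"
      using le le_atomD by blast+
    then show ?thesis
      using False \<open>x \<in> atoms\<close> by (auto simp: tnorm_of_def idem_atoms_def)
  qed
qed

text \<open>The suprema defining \<open>ext T a a\<close> run over singletons when \<open>a\<close>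
  is an atom. Hence the set can be read off the extension without choosing a
  \<open>T\<close>.\<close>

lemma idem_atoms_ext: "idem_atoms (ext T) = idem_atoms T"
  by (auto simp: idem_atoms_def ext_atom)

text \<open>If \<open>top\<close> were an atom, neutrality would make it idempotent for every
  \<open>S\<close>, so \<open>S\<close> could not be recovered.\<close>

lemma idem_atoms_tnorm_of:
  fixes S :: "'a::{order_bot, order_top} set"
  assumes "S \<subseteq> atoms" and "(top::'a) \<notin> atoms"
  shows "idem_atoms (tnorm_of S) = S"
  proof -
  have "a \<noteq> bot \<and> a \<noteq> top" if "a \<in> atoms" for a :: 'a
    using that assms(2) by (auto simp: atoms_def)
  then show ?thesis using assms(1) by (auto simp: idem_atoms_def tnorm_of_def)
qed

text \<open>\<open>ext\<close> sees only values on \<open>C\<close>, where any representing t-norm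
  agrees with its normal form \<open>tnorm_of\<close>.\<close>

lemma ext_tnorm_eq:
  assumes "F \<in> ext_tnorms"
  shows "ext (tnorm_of (idem_atoms F)) = F"
proof -
  obtain T where T: "tnorm_on C T" "F = ext T" using assms by (auto simp: ext_tnorms_def)
  have "ext T = ext (tnorm_of (idem_atoms T))"
    by (intro ext_cong tnorm_on_eq_tnorm_of T(1))
  then show ?thesis by (metis T(2) idem_atoms_ext)
qed

lemma tnorm_of_mono: "S \<subseteq> S' \<Longrightarrow> tnorm_of S x y \<le> tnorm_of S' x y"
  by (auto simp: tnorm_of_def)

theorem theorem5p1:
  assumes atomistic: "\<forall>x::'a::complete_lattice. \<exists>S\<subseteq>atoms. x = Sup S"
    and top_not_atom: "(top::'a) \<notin> atoms"
  shows "order_isomorphic (ext_tnorms :: ('a \<Rightarrow> 'a \<Rightarrow> 'a) set) (Pow (atoms :: 'a set))"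
proof -
  have "bij_betw idem_atoms (ext_tnorms :: ('a \<Rightarrow> 'a \<Rightarrow> 'a) set) (Pow atoms)"
  proof (rule bij_betw_byWitness[where f' = "\<lambda>S. ext (tnorm_of S)"])
    show "(\<lambda>S. ext (tnorm_of S)) ` Pow atoms \<subseteq> (ext_tnorms :: ('a \<Rightarrow> 'a \<Rightarrow> 'a) set)"
      using tnorm_on_tnorm_of by (auto simp: ext_tnorms_def)
    show "\<forall>S\<in>Pow atoms. idem_atoms (ext (tnorm_of S)) = (S :: 'a set)"
      using idem_atoms_tnorm_of top_not_atom by (auto simp only: idem_atoms_ext Pow_iff)
  qed (simp_all add: ext_tnorm_eq, auto simp: idem_atoms_def)
  moreover have "F \<le> G \<longleftrightarrow> idem_atoms F \<subseteq> idem_atoms G"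
    if FG: "F \<in> ext_tnorms" "G \<in> ext_tnorms" for F G :: "'a \<Rightarrow> 'a \<Rightarrow> 'a"
  proof
    assume "F \<le> G"
    show "idem_atoms F \<subseteq> idem_atoms G"
    proof
      fix a assume "a \<in> idem_atoms F"
      then have a: "a \<in> atoms" "F a a = a" by (auto simp: idem_atoms_def)
      obtain T where T: "tnorm_on C T" "G = ext T" using FG by (auto simp: ext_tnorms_def)
      have "a \<in> C" using a by (simp add: C_def)
      \<comment> \<open>In this form \<open>G a a\<close> can only be \<open>a\<close> or
        \<open>bot\<close>, and \<open>a \<le> G a a\<close> excludes \<open>bot\<close>.\<close>
      then have "G a a = tnorm_of (idem_atoms G) a a"
        using T a by (simp add: ext_atom idem_atoms_ext tnorm_on_eq_tnorm_of)
      moreover have "a \<le> G a a" using \<open>F \<le> G\<close> a by (metis le_funD)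
      moreover have "a \<noteq> bot" "a \<noteq> top" using a top_not_atom by (auto simp: atoms_def)
      ultimately show "a \<in> idem_atoms G"
        by (auto simp: tnorm_of_def bot_unique split: if_splits)
    qed
  next
    assume "idem_atoms F \<subseteq> idem_atoms G"
    \<comment> \<open>Arbitrary representatives of \<open>F\<close> and \<open>G\<close> are
      comparable only on \<open>C\<close>; the normal forms are comparable everywhere, as
      \<open>ext_mono\<close> requires.\<close>
    then have "ext (tnorm_of (idem_atoms F)) \<le> ext (tnorm_of (idem_atoms G))"
      by (intro ext_mono tnorm_of_mono)
    then show "F \<le> G" using FG by (simp add: ext_tnorm_eq)
  qed
  ultimately show ?thesis unfolding order_isomorphic_def by blast
qed

end
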